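(* (Lie-invariant density.) Let $D\subset\mathbb R^2$ be open with coordinates $(x,y)$, let $\varphi:D\to\mathbb R$ be smooth with $\sin\varphi\cos\varphi\neq0$, and let $(\kappa^1,s^1)$, $(\kappa^2,s^2)$ be two smooth solutions on $D$ of the linear system $\kappa_x=\tan\varphi\,s_x$, $\kappa_y=-\cot\varphi\,s_y$ with $s^1_x\ne0$, $s^1_y\ne0$. Let $A$ be a function with $dA=\kappa^1d\kappa^2+s^1ds^2$, let $B=\frac12\big((\kappa^1)^2+(s^1)^2+1\big)$, and set $$\lambda^1=\frac{s^2_x}{s^1_x},\quad \lambda^2=\frac{s^2_y}{s^1_y},\qquad \rho^1=\lambda^1B-A,\quad \rho^2=\lambda^2B-A .$$ Assume $\lambda^1\neq\lambda^2$ on $D$. Then $$\frac{\rho^1_x\rho^2_y}{(\rho^1-\rho^2)^2}\,dx\wedge dy=\frac{\lambda^1_x\lambda^2_y}{(\lambda^1-\lambda^2)^2}\,dx\wedge dy=\varphi_x\varphi_y\,dx\wedge dy-d\left(\frac{d\lambda^2}{\lambda^1-\lambda^2}\right).$$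
   Context: Here $\rho^1,\rho^2$ are the radii of principal curvature (in the convention ${\bf r}_x=\rho^1{\bf n}_x$, ${\bf r}_y=\rho^2{\bf n}_y$) of the surface in $E^3$ with radius-vector ${\bf r}=(\kappa^2-\kappa^1A/B,\ s^2-s^1A/B,\ -A/B)$ and unit normal ${\bf n}=(\kappa^1/B,\ s^1/B,\ 1/B-1)$, for which $x,y$ are coordinates of the lines of curvature. The integral $\int\int \frac{\rho^1_x\rho^2_y}{(\rho^1-\rho^2)^2}\,dx\,dy$ is Blaschke's Lie-invariant functional. All functions are smooth. *)

theory Defs
  imports "HOL-Analysis.Analysis"
begin

text \<open>All notions below are used on open sets \<open>D\<close> only, where derivatives at a point of \<open>D\<close>
  do not depend on the values outside \<open>D\<close>.\<close>

primrec Ck_on :: "nat \<Rightarrow> ('a::real_normed_vector \<Rightarrow> 'b::real_normed_vector) \<Rightarrow> 'a set \<Rightarrow> bool" where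
  "Ck_on 0 f D \<longleftrightarrow> continuous_on D f"
| "Ck_on (Suc k) f D \<longleftrightarrow> (\<forall>p\<in>D. f differentiable at p) \<and>
     (\<forall>v. Ck_on k (\<lambda>p. frechet_derivative f (at p) v) D)"

definition smooth_on :: "('a::real_normed_vector \<Rightarrow> 'b::real_normed_vector) \<Rightarrow> 'a set \<Rightarrow> bool" where
  "smooth_on f D \<longleftrightarrow> (\<forall>k. Ck_on k f D)"

definition pd_x :: "(real \<times> real \<Rightarrow> real) \<Rightarrow> real \<times> real \<Rightarrow> real" where
  "pd_x f p = deriv (\<lambda>x. f (x, snd p)) (fst p)"

definition pd_y :: "(real \<times> real \<Rightarrow> real) \<Rightarrow> real \<times> real \<Rightarrow> real" where
  "pd_y f p = deriv (\<lambda>y. f (fst p, y)) (snd p)"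

text \<open>A 1-form assigns to a point a linear functional of one tangent vector, a 2-form an
  alternating bilinear functional of two tangent vectors. The wedge product and the exterior
  derivative are normalised so that \<open>(\<alpha> \<and> \<beta>)(u, v) = \<alpha>(u) \<beta>(v) - \<alpha>(v) \<beta>(u)\<close> and
  \<open>d(f \<omega>) = df \<and> \<omega> + f d\<omega>\<close>.\<close>

type_synonym 'a form1 = "'a \<Rightarrow> 'a \<Rightarrow> real"
type_synonym 'a form2 = "'a \<Rightarrow> 'a \<Rightarrow> 'a \<Rightarrow> real"

definition wedge :: "'a form1 \<Rightarrow> 'a form1 \<Rightarrow> 'a form2" where
  "wedge \<alpha> \<beta> p u v = \<alpha> p u * \<beta> p v - \<alpha> p v * \<beta> p u"

definition ext_d0 :: "('a::real_normed_vector \<Rightarrow> real) \<Rightarrow> 'a form1" where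
  "ext_d0 f p u = frechet_derivative f (at p) u"

definition ext_d1 :: "'a::real_normed_vector form1 \<Rightarrow> 'a form2" where
  "ext_d1 \<omega> p u v =
     frechet_derivative (\<lambda>q. \<omega> q v) (at p) u - frechet_derivative (\<lambda>q. \<omega> q u) (at p) v"

definition dx_dy :: "(real \<times> real) form2" where
  "dx_dy = wedge (ext_d0 fst) (ext_d0 snd)"

end

theory Submission
  imports Defs
begin

text \<open>Compatibility \<open>\<kappa>\<^sub>x\<^sub>y = \<kappa>\<^sub>y\<^sub>x\<close> turns the linear system into
  \<open>s\<^sub>x\<^sub>y = cot \<phi> \<phi>\<^sub>x s\<^sub>y - tan \<phi> \<phi>\<^sub>y s\<^sub>x\<close>, for both solutions. Hence the cross derivatives are
  \<open>\<lambda>\<^sup>1\<^sub>y = - cot \<phi> \<phi>\<^sub>x (\<lambda>\<^sup>1 - \<lambda>\<^sup>2) s\<^sup>1\<^sub>y / s\<^sup>1\<^sub>x\<close> and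
  \<open>\<lambda>\<^sup>2\<^sub>x = - tan \<phi> \<phi>\<^sub>y (\<lambda>\<^sup>1 - \<lambda>\<^sup>2) s\<^sup>1\<^sub>x / s\<^sup>1\<^sub>y\<close>, so that
  \<open>\<lambda>\<^sup>1\<^sub>y \<lambda>\<^sup>2\<^sub>x = \<phi>\<^sub>x \<phi>\<^sub>y (\<lambda>\<^sup>1 - \<lambda>\<^sup>2)\<^sup>2\<close>, while
  \<open>d (d\<lambda>\<^sup>2 / (\<lambda>\<^sup>1 - \<lambda>\<^sup>2)) = - d\<lambda>\<^sup>1 \<and> d\<lambda>\<^sup>2 / (\<lambda>\<^sup>1 - \<lambda>\<^sup>2)\<^sup>2\<close>.
  Since \<open>A\<^sub>x = \<lambda>\<^sup>1 B\<^sub>x\<close> and \<open>A\<^sub>y = \<lambda>\<^sup>2 B\<^sub>y\<close>, one has \<open>\<rho>\<^sup>1\<^sub>x = \<lambda>\<^sup>1\<^sub>x B\<close>, \<open>\<rho>\<^sup>2\<^sub>y = \<lambda>\<^sup>2\<^sub>y B\<close>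
  and \<open>\<rho>\<^sup>1 - \<rho>\<^sup>2 = (\<lambda>\<^sup>1 - \<lambda>\<^sup>2) B\<close>: the factors \<open>B\<close> cancel.\<close>

section \<open>Symmetry of second derivatives\<close>

lemma second_difference_tendsto:
  fixes f :: "'a::real_normed_vector \<Rightarrow> real"
  assumes D: "open D" "p \<in> D"
    and f: "\<And>q. q \<in> D \<Longrightarrow> (f has_derivative f' q) (at q)"
    and g: "((\<lambda>q. f' q u) has_derivative G) (at p)"
  shows "((\<lambda>t. (f (p + t *\<^sub>R u + t *\<^sub>R v) - f (p + t *\<^sub>R u) - f (p + t *\<^sub>R v) + f p) / t\<^sup>2)
           \<longlongrightarrow> G v) (at_right 0)"
proof (rule tendstoI)
  fix e :: real assume e: "e > 0"
  \<comment> \<open>The summand 1 keeps \<open>M\<close> positive even when \<open>u\<close> and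
    \<open>v\<close> both vanish.\<close>
  define M where "M = norm u + norm v + 1"
  have M: "M > 0" "norm u \<le> M" "norm u + norm v \<le> M" by (auto simp: M_def add_nonneg_pos)
  \<comment> \<open>Each of the remainders \<open>R t\<close> and \<open>R 0\<close> will be at most
    \<open>e' * (t * M)\<close>, a quarter of \<open>e * t\<close>, so their difference over
    \<open>t\<close> is at most \<open>e / 2\<close>.\<close>
  define e' where "e' = e / (4 * M)"
  have e': "e' > 0" using e M by (simp add: e'_def)
  interpret G: bounded_linear G using g by (rule has_derivative_bounded_linear)
  obtain d1 where d1: "d1 > 0"
    and d1': "\<And>y. norm (y - p) < d1 \<Longrightarrow> norm (f' y u - f' p u - G (y - p)) \<le> e' * norm (y - p)"
    using g e' unfolding has_derivative_at_alt by blast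
  obtain d2 where d2: "d2 > 0" "ball p d2 \<subseteq> D"
    using D by (meson open_contains_ball)
  define d where "d = min d1 d2 / M"
  have d: "d > 0" using d1 d2 M by (simp add: d_def)
  have bound: "dist ((f (p + t *\<^sub>R u + t *\<^sub>R v) - f (p + t *\<^sub>R u) - f (p + t *\<^sub>R v) + f p) / t\<^sup>2) (G v) < e"
    if t: "0 < t" "t < d" for t
  proof -
    have tM: "t * M < d1" "t * M < d2"
      using t M by (auto simp: d_def field_simps)
    have small: "norm (r *\<^sub>R u + t' *\<^sub>R v) \<le> t * M"
      if "0 \<le> r" "r \<le> t" "0 \<le> t'" "t' \<le> t" for r t'
    proof -
      have "norm (r *\<^sub>R u + t' *\<^sub>R v) \<le> r * norm u + t' * norm v"
        using norm_triangle_ineq[of "r *\<^sub>R u" "t' *\<^sub>R v"] that by simp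
      also have "\<dots> \<le> t * norm u + t * norm v"
        using that by (intro add_mono mult_right_mono) auto
      also have "\<dots> \<le> t * M" using M t by (simp add: distrib_left[symmetric])
      finally show ?thesis .
    qed
    have inD: "p + r *\<^sub>R u + t' *\<^sub>R v \<in> D"
      if "0 \<le> r" "r \<le> t" "0 \<le> t'" "t' \<le> t" for r t'
    proof -
      have "dist (p + r *\<^sub>R u + t' *\<^sub>R v) p = norm (r *\<^sub>R u + t' *\<^sub>R v)"
        by (simp add: dist_norm add.assoc)
      with small[OF that] tM d2 show ?thesis by (auto simp: dist_commute intro!: subsetD[OF d2(2)])
    qed
    \<comment> \<open>The summand \<open>0 *\<^sub>R v\<close> makes both terms instances of
      \<open>line\<close>.\<close>
    define \<psi> where "\<psi> r = f (p + r *\<^sub>R u + t *\<^sub>R v) - f (p + r *\<^sub>R u + 0 *\<^sub>R v)" for r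
    have line: "((\<lambda>r. f (p + r *\<^sub>R u + t' *\<^sub>R v)) has_derivative
        (\<lambda>h. h * f' (p + r *\<^sub>R u + t' *\<^sub>R v) u)) (at r)"
      if "0 \<le> r" "r \<le> t" "0 \<le> t'" "t' \<le> t" for r t'
    proof -
      interpret f': bounded_linear "f' (p + r *\<^sub>R u + t' *\<^sub>R v)"
        using f[OF inD[OF that]] by (rule has_derivative_bounded_linear)
      have "((\<lambda>r. p + r *\<^sub>R u + t' *\<^sub>R v) has_derivative (\<lambda>h. h *\<^sub>R u)) (at r)"
        by (auto intro!: derivative_eq_intros)
      from has_derivative_compose[OF this f[OF inD[OF that]]]
      show ?thesis by (simp add: f'.scaleR)
    qed
    have \<psi>: "(\<psi> has_derivative
        (\<lambda>h. h * f' (p + r *\<^sub>R u + t *\<^sub>R v) u - h * f' (p + r *\<^sub>R u + 0 *\<^sub>R v) u)) (at r)"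
      if "0 \<le> r" "r \<le> t" for r
      unfolding \<psi>_def using that t by (intro has_derivative_diff line) auto
    obtain r where r: "0 < r" "r < t"
      and mv: "\<psi> t - \<psi> 0 = (t - 0) * f' (p + r *\<^sub>R u + t *\<^sub>R v) u - (t - 0) * f' (p + r *\<^sub>R u + 0 *\<^sub>R v) u"
    proof (rule mvt[OF t(1), of \<psi>
          "\<lambda>r h. h * f' (p + r *\<^sub>R u + t *\<^sub>R v) u - h * f' (p + r *\<^sub>R u + 0 *\<^sub>R v) u"])
      show "continuous_on {0..t} \<psi>"
        by (intro continuous_at_imp_continuous_on ballI has_derivative_continuous[OF \<psi>]) auto
    qed (use \<psi> in auto)
    \<comment> \<open>This is the linearisation error of \<open>f' q u\<close> at \<open>p\<close>.
      In \<open>R t - R 0\<close> the terms \<open>f' p u\<close> and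
      \<open>G (r *\<^sub>R u)\<close> cancel, so the unknown intermediate value \<open>r\<close>
      disappears from the main term \<open>t * G v\<close>.\<close>
    define R where "R t' = f' (p + r *\<^sub>R u + t' *\<^sub>R v) u - f' p u - G (r *\<^sub>R u + t' *\<^sub>R v)" for t'
    have R: "\<bar>R t'\<bar> \<le> e' * (t * M)" if "0 \<le> t'" "t' \<le> t" for t'
    proof -
      have s: "norm (r *\<^sub>R u + t' *\<^sub>R v) \<le> t * M" using small that r by simp
      have "\<bar>R t'\<bar> \<le> e' * norm (r *\<^sub>R u + t' *\<^sub>R v)"
        using d1'[of "p + r *\<^sub>R u + t' *\<^sub>R v"] s tM by (simp add: R_def add.assoc)
      also have "\<dots> \<le> e' * (t * M)" using s e' by simp
      finally show ?thesis .
    qed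
    have eq: "f (p + t *\<^sub>R u + t *\<^sub>R v) - f (p + t *\<^sub>R u) - f (p + t *\<^sub>R v) + f p = t * (R t - R 0 + t * G v)"
      using mv by (simp add: \<psi>_def R_def G.add G.scaleR algebra_simps)
    have "(f (p + t *\<^sub>R u + t *\<^sub>R v) - f (p + t *\<^sub>R u) - f (p + t *\<^sub>R v) + f p) / t\<^sup>2 - G v
        = (R t - R 0) / t"
      unfolding eq using t by (simp add: power2_eq_square add_divide_distrib)
    moreover have "\<bar>R t - R 0\<bar> \<le> 2 * e' * (t * M)" using R[of t] R[of 0] t by linarith
    then have "\<bar>(R t - R 0) / t\<bar> \<le> e / 2"
      using t M by (simp add: e'_def field_simps)
    ultimately show ?thesis using e unfolding dist_real_def by linarith
  qed
  show "\<forall>\<^sub>F t in at_right 0. dist ((f (p + t *\<^sub>R u + t *\<^sub>R v) - f (p + t *\<^sub>R u) - f (p + t *\<^sub>R v) + f p) / t\<^sup>2) (G v) < e"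
    using d bound by (auto simp: eventually_at_right_field intro!: exI[of _ d])
qed

text \<open>The second difference is unchanged when \<open>u\<close> and \<open>v\<close> are
  exchanged, so \<open>G v\<close> and \<open>H u\<close> are limits of the same quotient.\<close>

lemma second_derivative_symmetric:
  fixes f :: "'a::real_normed_vector \<Rightarrow> real"
  assumes D: "open D" "p \<in> D"
    and f: "\<And>q. q \<in> D \<Longrightarrow> (f has_derivative f' q) (at q)"
    and u: "((\<lambda>q. f' q u) has_derivative G) (at p)"
    and v: "((\<lambda>q. f' q v) has_derivative H) (at p)"
  shows "G v = H u"
proof -
  note second_difference_tendsto[OF D f u, of v]
  moreover have "((\<lambda>t. (f (p + t *\<^sub>R u + t *\<^sub>R v) - f (p + t *\<^sub>R u) - f (p + t *\<^sub>R v) + f p) / t\<^sup>2)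
      \<longlongrightarrow> H u) (at_right 0)"
    using second_difference_tendsto[OF D f v, of u] by (simp add: algebra_simps)
  ultimately show ?thesis
    using tendsto_unique trivial_limit_at_right_real by blast
qed

section \<open>Closure properties of smooth functions\<close>

text \<open>On an open set, equality on \<open>D\<close> is equality near each point of
  \<open>D\<close>, so it passes to all derivatives. This covers functions that are prescribed on
  \<open>D\<close> only.\<close>

lemma Ck_on_cong:
  assumes "open D" "\<And>p. p \<in> D \<Longrightarrow> f p = g p" "Ck_on k f D"
  shows "Ck_on k g D"
  using assms(2,3)
proof (induction k arbitrary: f g)
  case 0
  then show ?case by (simp cong: continuous_on_cong)
next
  case (Suc k)
  have "g differentiable at p" if "p \<in> D" for p
    using Suc.prems that assms(1) has_derivative_transform_within_open[of f _ p UNIV D g]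
    unfolding Ck_on.simps differentiable_def by blast
  moreover have "Ck_on k (\<lambda>p. frechet_derivative g (at p) v) D" for v
  proof (rule Suc.IH)
    show "Ck_on k (\<lambda>p. frechet_derivative f (at p) v) D" using Suc.prems by simp
    show "frechet_derivative f (at p) v = frechet_derivative g (at p) v" if "p \<in> D" for p
      using frechet_derivative_transform_within_open[of f p D g] Suc.prems assms(1) that by simp
  qed
  ultimately show ?case by simp
qed

lemma Ck_on_SucD: "Ck_on (Suc k) f D \<Longrightarrow> Ck_on k f D"
proof (induction k arbitrary: f)
  case 0
  then show ?case
    by (auto intro!: continuous_at_imp_continuous_on differentiable_imp_continuous_within)
next
  case (Suc k)
  then show ?case by (simp del: Ck_on.simps(2) add: Ck_on.simps(2)[of "Suc k"] Ck_on.simps(2)[of k f])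
qed

text \<open>Allows any explicit derivative in place of \<open>frechet_derivative\<close>, so that
  the rules of differentiation apply in the closure proofs.\<close>

lemma Ck_on_SucI:
  assumes "open D" "\<And>p. p \<in> D \<Longrightarrow> (f has_derivative f' p) (at p)"
    and "\<And>v. Ck_on k (\<lambda>p. f' p v) D"
  shows "Ck_on (Suc k) f D"
proof -
  have "frechet_derivative f (at p) = f' p" if "p \<in> D" for p
    using frechet_derivative_at assms(2)[OF that] by metis
  then show ?thesis
    using assms by (auto simp: differentiable_def intro!: Ck_on_cong[OF assms(1) _ assms(3)])
qed

lemma Ck_on_SucE:
  assumes "Ck_on (Suc k) f D" "p \<in> D"
  shows "(f has_derivative frechet_derivative f (at p)) (at p)"
  using assms frechet_derivative_works by auto

lemma Ck_on_diff:
  fixes f g :: "'a::real_normed_vector \<Rightarrow> real"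
  assumes "open D"
  shows "Ck_on k f D \<Longrightarrow> Ck_on k g D \<Longrightarrow> Ck_on k (\<lambda>p. f p - g p) D"
proof (induction k arbitrary: f g)
  case 0
  then show ?case by (auto intro: continuous_intros)
next
  case (Suc k)
  show ?case
    by (rule Ck_on_SucI[OF assms has_derivative_diff[OF Suc.prems[THEN Ck_on_SucE]]])
      (use Suc in auto)
qed

lemma Ck_on_add:
  fixes f g :: "'a::real_normed_vector \<Rightarrow> real"
  assumes "open D"
  shows "Ck_on k f D \<Longrightarrow> Ck_on k g D \<Longrightarrow> Ck_on k (\<lambda>p. f p + g p) D"
proof (induction k arbitrary: f g)
  case 0
  then show ?case by (auto intro: continuous_intros)
next
  case (Suc k)
  show ?case
    by (rule Ck_on_SucI[OF assms has_derivative_add[OF Suc.prems[THEN Ck_on_SucE]]])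
      (use Suc in auto)
qed

lemma Ck_on_mult:
  fixes f g :: "'a::real_normed_vector \<Rightarrow> real"
  assumes "open D"
  shows "Ck_on k f D \<Longrightarrow> Ck_on k g D \<Longrightarrow> Ck_on k (\<lambda>p. f p * g p) D"
proof (induction k arbitrary: f g)
  case 0
  then show ?case by (auto intro: continuous_intros)
next
  case (Suc k)
  have "Ck_on k (\<lambda>p. frechet_derivative f (at p) v) D" "Ck_on k (\<lambda>p. frechet_derivative g (at p) v) D" for v
    using Suc.prems by auto
  then show ?case
    by (intro Ck_on_SucI[OF assms has_derivative_mult[OF Suc.prems[THEN Ck_on_SucE]]]
        Ck_on_add[OF assms] Suc.IH Suc.prems[THEN Ck_on_SucD])
qed

text \<open>The quotient rule gives again a quotient, of a difference of products by
  \<open>g p * g p\<close>, so the induction over all \<open>f\<close> and \<open>g\<close>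
  closes.\<close>

lemma Ck_on_divide:
  fixes f g :: "'a::real_normed_vector \<Rightarrow> real"
  assumes "open D"
  shows "Ck_on k f D \<Longrightarrow> Ck_on k g D \<Longrightarrow> (\<And>p. p \<in> D \<Longrightarrow> g p \<noteq> 0) \<Longrightarrow> Ck_on k (\<lambda>p. f p / g p) D"
proof (induction k arbitrary: f g)
  case 0
  then show ?case by (auto intro: continuous_intros)
next
  case (Suc k)
  have "Ck_on k (\<lambda>p. frechet_derivative f (at p) v) D" "Ck_on k (\<lambda>p. frechet_derivative g (at p) v) D" for v
    using Suc.prems by auto
  moreover have "g p * g p \<noteq> 0" if "p \<in> D" for p
    using Suc.prems(3)[OF that] by simp
  ultimately show ?case
    by (intro Ck_on_SucI[OF assms has_derivative_divide'[OF Suc.prems(1,2)[THEN Ck_on_SucE] Suc.prems(3)]]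
        Suc.IH Ck_on_diff[OF assms] Ck_on_mult[OF assms] Suc.prems(1,2)[THEN Ck_on_SucD])
qed

lemma smooth_on_differentiable:
  "smooth_on f D \<Longrightarrow> p \<in> D \<Longrightarrow> f differentiable at p"
  unfolding smooth_on_def using Ck_on.simps(2) by blast

lemma smooth_on_frechet_derivative:
  "smooth_on f D \<Longrightarrow> smooth_on (\<lambda>p. frechet_derivative f (at p) v) D"
  unfolding smooth_on_def using Ck_on.simps(2) by blast

lemma smooth_on_cong:
  "open D \<Longrightarrow> (\<And>p. p \<in> D \<Longrightarrow> f p = g p) \<Longrightarrow> smooth_on f D \<Longrightarrow> smooth_on g D"
  unfolding smooth_on_def using Ck_on_cong by blast

lemma smooth_on_divide:
  fixes f g :: "'a::real_normed_vector \<Rightarrow> real"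
  assumes "open D" "smooth_on f D" "smooth_on g D" "\<And>p. p \<in> D \<Longrightarrow> g p \<noteq> 0"
  shows "smooth_on (\<lambda>p. f p / g p) D"
  using assms Ck_on_divide unfolding smooth_on_def by blast

section \<open>Partial derivatives\<close>

text \<open>The chain rule along the horizontal and the vertical line through
  \<open>p\<close>.\<close>

lemma
  assumes "(f has_derivative f') (at p)"
  shows pd_x_eq: "pd_x f p = f' (1, 0)" and pd_y_eq: "pd_y f p = f' (0, 1)"
proof -
  interpret f': bounded_linear f' using assms by (rule has_derivative_bounded_linear)
  have f: "(f has_derivative f') (at (fst p, snd p))" using assms by simp
  have "((\<lambda>x. (x, snd p)) has_derivative (\<lambda>h. (h, 0))) (at (fst p))"
    by (auto intro!: derivative_eq_intros)
  from has_derivative_compose[OF this f]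
  have "((\<lambda>x. f (x, snd p)) has_derivative (\<lambda>h. f' (h, 0))) (at (fst p))" .
  moreover have "(\<lambda>h. f' (h, 0)) = (*) (f' (1, 0))"
  proof
    show "f' (h, 0) = f' (1, 0) * h" for h
      using f'.scaleR[of h "(1, 0)"] by simp
  qed
  ultimately show "pd_x f p = f' (1, 0)"
    unfolding pd_x_def by (intro DERIV_imp_deriv) (simp add: has_field_derivative_def)
  have "((\<lambda>y. (fst p, y)) has_derivative (\<lambda>h. (0, h))) (at (snd p))"
    by (auto intro!: derivative_eq_intros)
  from has_derivative_compose[OF this f]
  have "((\<lambda>y. f (fst p, y)) has_derivative (\<lambda>h. f' (0, h))) (at (snd p))" .
  moreover have "(\<lambda>h. f' (0, h)) = (*) (f' (0, 1))"
  proof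
    show "f' (0, h) = f' (0, 1) * h" for h
      using f'.scaleR[of h "(0, 1)"] by simp
  qed
  ultimately show "pd_y f p = f' (0, 1)"
    unfolding pd_y_def by (intro DERIV_imp_deriv) (simp add: has_field_derivative_def)
qed

lemma has_derivative_pd:
  assumes "f differentiable at p"
  shows "(f has_derivative (\<lambda>w. pd_x f p * fst w + pd_y f p * snd w)) (at p)"
proof -
  obtain f' where f': "(f has_derivative f') (at p)" using assms unfolding differentiable_def by blast
  interpret f': bounded_linear f' using f' by (rule has_derivative_bounded_linear)
  have "f' w = pd_x f p * fst w + pd_y f p * snd w" for w
  proof -
    have "f' w = f' (fst w *\<^sub>R (1, 0) + snd w *\<^sub>R (0, 1))" by simp
    also have "\<dots> = fst w * f' (1, 0) + snd w * f' (0, 1)"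
      by (simp only: f'.add f'.scaleR real_scaleR_def)
    finally show ?thesis using pd_x_eq[OF f'] pd_y_eq[OF f'] by simp
  qed
  then have "f' = (\<lambda>w. pd_x f p * fst w + pd_y f p * snd w)" by blast
  with f' show ?thesis by simp
qed

lemma ext_d0_eq:
  "f differentiable at p \<Longrightarrow> ext_d0 f p w = pd_x f p * fst w + pd_y f p * snd w"
  using fun_cong[OF frechet_derivative_at[OF has_derivative_pd], of f p w] by (simp add: ext_d0_def)

lemmas smooth_on_has_derivative = has_derivative_pd[OF smooth_on_differentiable]

lemma pd_eq_frechet_derivative:
  assumes "f differentiable at p"
  shows "pd_x f p = frechet_derivative f (at p) (1, 0)"
    and "pd_y f p = frechet_derivative f (at p) (0, 1)"
  by (rule pd_x_eq[OF assms[unfolded frechet_derivative_works]])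
    (rule pd_y_eq[OF assms[unfolded frechet_derivative_works]])

lemma smooth_on_pd:
  assumes "open D" "smooth_on f D"
  shows "smooth_on (pd_x f) D" "smooth_on (pd_y f) D"
  by (rule smooth_on_cong[OF assms(1) _ smooth_on_frechet_derivative[OF assms(2)]],
      rule pd_eq_frechet_derivative[symmetric, OF smooth_on_differentiable[OF assms(2)]], assumption)+

lemma pd_commute:
  assumes "open D" "smooth_on f D" "p \<in> D"
  shows "pd_x (pd_y f) p = pd_y (pd_x f) p"
proof -
  have f: "\<And>q. q \<in> D \<Longrightarrow> (f has_derivative (\<lambda>w. pd_x f q * fst w + pd_y f q * snd w)) (at q)"
    by (rule smooth_on_has_derivative[OF assms(2)])
  \<comment> \<open>The form is left evaluated at a basis vector to match the pattern
    \<open>f' q u\<close> of the symmetry lemma.\<close>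
  have y: "((\<lambda>q. pd_x f q * fst (0::real, 1::real) + pd_y f q * snd (0::real, 1::real)) has_derivative
      (\<lambda>w. pd_x (pd_y f) p * fst w + pd_y (pd_y f) p * snd w)) (at p)"
    using smooth_on_has_derivative[OF smooth_on_pd(2)[OF assms(1,2)] assms(3)] by simp
  have x: "((\<lambda>q. pd_x f q * fst (1::real, 0::real) + pd_y f q * snd (1::real, 0::real)) has_derivative
      (\<lambda>w. pd_x (pd_x f) p * fst w + pd_y (pd_x f) p * snd w)) (at p)"
    using smooth_on_has_derivative[OF smooth_on_pd(1)[OF assms(1,2)] assms(3)] by simp
  show ?thesis using second_derivative_symmetric[OF assms(1,3) f y x] by simp
qed

section \<open>Exterior calculus in coordinates\<close>

lemma dx_dy_eq: "dx_dy p u v = fst u * snd v - fst v * snd u"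
proof -
  have "frechet_derivative fst (at p) = fst" "frechet_derivative snd (at p) = snd"
    by (metis bounded_linear_fst bounded_linear_imp_has_derivative frechet_derivative_at)
      (metis bounded_linear_snd bounded_linear_imp_has_derivative frechet_derivative_at)
  then show ?thesis by (simp add: dx_dy_def wedge_def ext_d0_def)
qed

text \<open>In invariant terms, d(dg / h) = - (dh \<and> dg) / h^2, because d(dg) = 0.\<close>

lemma ext_d1_divide:
  assumes D: "open D" "p \<in> D" and g: "smooth_on g D" and h: "h differentiable at p" "h p \<noteq> 0"
  shows "ext_d1 (\<lambda>q w. ext_d0 g q w / h q) p u v
       = - ((pd_x h p * pd_y g p - pd_y h p * pd_x g p) / (h p)\<^sup>2) * dx_dy p u v"
proof -
  define gxx gxy gyy where "gxx = pd_x (pd_x g) p" "gxy = pd_y (pd_x g) p" "gyy = pd_y (pd_y g) p"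
  have gx: "(pd_x g has_derivative (\<lambda>w. gxx * fst w + gxy * snd w)) (at p)"
    and gy: "(pd_y g has_derivative (\<lambda>w. gxy * fst w + gyy * snd w)) (at p)"
    using smooth_on_has_derivative[OF smooth_on_pd(1)[OF D(1) g] D(2)]
      smooth_on_has_derivative[OF smooth_on_pd(2)[OF D(1) g] D(2)] pd_commute[OF D(1) g D(2)]
    by (simp_all add: gxx_gxy_gyy_def)
  \<comment> \<open>Numerator of the quotient rule: \<open>w\<close> is the argument of the form,
    \<open>z\<close> the direction of differentiation. As \<open>gxy\<close> stands for both mixed
    derivatives, the Hessian part is symmetric in \<open>w\<close> and \<open>z\<close> and drops
    out of \<open>N v u - N u v\<close>.\<close>
  define N where "N w z =
      ((gxx * fst z + gxy * snd z) * fst w + (gxy * fst z + gyy * snd z) * snd w) * h p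
        - (pd_x g p * fst w + pd_y g p * snd w) * (pd_x h p * fst z + pd_y h p * snd z)" for w z
  have *: "frechet_derivative (\<lambda>q. ext_d0 g q w / h q) (at p) z = N w z / (h p)\<^sup>2" for w z
  proof -
    have "((\<lambda>q. (pd_x g q * fst w + pd_y g q * snd w) / h q) has_derivative
      (\<lambda>z. N w z / (h p)\<^sup>2)) (at p)"
      using h(2)
      by (auto intro!: derivative_eq_intros gx gy has_derivative_pd[OF h(1)] simp: N_def power2_eq_square)
    then have "((\<lambda>q. ext_d0 g q w / h q) has_derivative
      (\<lambda>z. N w z / (h p)\<^sup>2)) (at p)"
      by (rule has_derivative_transform_within_open[OF _ D])
        (simp add: ext_d0_eq smooth_on_differentiable[OF g])
    from frechet_derivative_at[OF this] show ?thesis by metis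
  qed
  have N: "N v u - N u v = - (pd_x h p * pd_y g p - pd_y h p * pd_x g p) * (fst u * snd v - fst v * snd u)"
    by (simp add: N_def algebra_simps)
  show ?thesis
    unfolding ext_d1_def * dx_dy_eq diff_divide_distrib[symmetric] N
    by (simp only: minus_divide_left times_divide_eq_left)
qed

section \<open>The invariant density\<close>

text \<open>Equating the mixed derivatives of \<open>k\<close> gives a linear equation for the mixed
  derivative of \<open>s\<close>. Its coefficient tan + cot = 1 / (sin cos) is nonzero, so the
  equation can be solved.\<close>

lemma compatibility_condition:
  assumes D: "open D" "p \<in> D" and sm: "smooth_on \<phi> D" "smooth_on k D" "smooth_on s D"
    and nz: "\<forall>p\<in>D. sin (\<phi> p) * cos (\<phi> p) \<noteq> 0"
    and sys: "\<forall>p\<in>D. pd_x k p = tan (\<phi> p) * pd_x s p \<and> pd_y k p = - cot (\<phi> p) * pd_y s p"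
  shows "pd_y (pd_x s) p = cot (\<phi> p) * pd_x \<phi> p * pd_y s p - tan (\<phi> p) * pd_y \<phi> p * pd_x s p"
proof -
  note d = smooth_on_has_derivative[OF _ D(2)]
  note sx = smooth_on_pd(1)[OF D(1) sm(3)] and sy = smooth_on_pd(2)[OF D(1) sm(3)]
  have nzp: "sin (\<phi> p) \<noteq> 0" "cos (\<phi> p) \<noteq> 0" using nz D by auto
  have "(pd_x k has_derivative (\<lambda>w.
      (pd_x \<phi> p * fst w + pd_y \<phi> p * snd w) * inverse ((cos (\<phi> p))\<^sup>2) * pd_x s p
      + tan (\<phi> p) * (pd_x (pd_x s) p * fst w + pd_y (pd_x s) p * snd w))) (at p)"
    by (rule has_derivative_transform_within_open[OF _ D, of "\<lambda>q. tan (\<phi> q) * pd_x s q"])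
      (use nzp sys in \<open>auto intro!: derivative_eq_intros d sm sx simp: algebra_simps\<close>)
  from pd_y_eq[OF this] have 1: "pd_y (pd_x k) p
      = pd_y \<phi> p * inverse ((cos (\<phi> p))\<^sup>2) * pd_x s p + tan (\<phi> p) * pd_y (pd_x s) p"
    by simp
  have "(pd_y k has_derivative (\<lambda>w.
      (pd_x \<phi> p * fst w + pd_y \<phi> p * snd w) * inverse ((sin (\<phi> p))\<^sup>2) * pd_y s p
      - cot (\<phi> p) * (pd_x (pd_y s) p * fst w + pd_y (pd_y s) p * snd w))) (at p)"
    by (rule has_derivative_transform_within_open[OF _ D, of "\<lambda>q. - cot (\<phi> q) * pd_y s q"])
      (use nzp sys in \<open>auto intro!: derivative_eq_intros DERIV_cot[THEN DERIV_compose_FDERIV] d sm sy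
        simp: algebra_simps\<close>)
  from pd_x_eq[OF this] have 2: "pd_x (pd_y k) p
      = pd_x \<phi> p * inverse ((sin (\<phi> p))\<^sup>2) * pd_y s p - cot (\<phi> p) * pd_x (pd_y s) p"
    by simp
  define S C where "S = sin (\<phi> p)" "C = cos (\<phi> p)"
  have SC: "S \<noteq> 0" "C \<noteq> 0" "S\<^sup>2 + C\<^sup>2 = 1" using nzp by (auto simp: S_C_def)
  define X Y fx fy m where "X = pd_x s p" "Y = pd_y s p" "fx = pd_x \<phi> p" "fy = pd_y \<phi> p"
    "m = pd_y (pd_x s) p"
  have eq: "fy / C\<^sup>2 * X + S / C * m = fx / S\<^sup>2 * Y - C / S * m"
    using 1 2 pd_commute[OF D(1) sm(2) D(2)] pd_commute[OF D(1) sm(3) D(2)]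
    by (simp add: S_C_def X_Y_fx_fy_m_def tan_def cot_def divide_inverse)
  have "S / C * m + C / S * m = m * (S\<^sup>2 + C\<^sup>2) / (S * C)"
    using SC(1,2) by (simp add: divide_simps power2_eq_square) (simp add: algebra_simps)
  then have "m / (S * C) = fx / S\<^sup>2 * Y - fy / C\<^sup>2 * X" using eq SC(3) by simp
  then have "m = (fx / S\<^sup>2 * Y - fy / C\<^sup>2 * X) * (S * C)" using SC by (simp add: divide_eq_eq)
  also have "\<dots> = C / S * fx * Y - S / C * fy * X"
    using SC(1,2) by (simp add: field_simps power2_eq_square)
  finally show ?thesis by (simp add: S_C_def X_Y_fx_fy_m_def tan_def cot_def)
qed

theorem mainTheorem5:
  fixes D :: "(real \<times> real) set"
    and \<phi> \<kappa>\<^sub>1 s\<^sub>1 \<kappa>\<^sub>2 s\<^sub>2 A B lam\<^sub>1 lam\<^sub>2 \<rho>\<^sub>1 \<rho>\<^sub>2 :: "real \<times> real \<Rightarrow> real"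
  assumes "open D"
    and "smooth_on \<phi> D"
    and "\<forall>p\<in>D. sin (\<phi> p) * cos (\<phi> p) \<noteq> 0"
    and "smooth_on \<kappa>\<^sub>1 D" "smooth_on s\<^sub>1 D" "smooth_on \<kappa>\<^sub>2 D" "smooth_on s\<^sub>2 D"
    and "\<forall>p\<in>D. pd_x \<kappa>\<^sub>1 p = tan (\<phi> p) * pd_x s\<^sub>1 p \<and> pd_y \<kappa>\<^sub>1 p = - cot (\<phi> p) * pd_y s\<^sub>1 p"
    and "\<forall>p\<in>D. pd_x \<kappa>\<^sub>2 p = tan (\<phi> p) * pd_x s\<^sub>2 p \<and> pd_y \<kappa>\<^sub>2 p = - cot (\<phi> p) * pd_y s\<^sub>2 p"
    and "\<forall>p\<in>D. pd_x s\<^sub>1 p \<noteq> 0" "\<forall>p\<in>D. pd_y s\<^sub>1 p \<noteq> 0"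
    and "smooth_on A D"
    and "\<forall>p\<in>D. \<forall>u. ext_d0 A p u = \<kappa>\<^sub>1 p * ext_d0 \<kappa>\<^sub>2 p u + s\<^sub>1 p * ext_d0 s\<^sub>2 p u"
    and "\<forall>p\<in>D. B p = 1/2 * ((\<kappa>\<^sub>1 p)\<^sup>2 + (s\<^sub>1 p)\<^sup>2 + 1)"
    and "\<forall>p\<in>D. lam\<^sub>1 p = pd_x s\<^sub>2 p / pd_x s\<^sub>1 p"
    and "\<forall>p\<in>D. lam\<^sub>2 p = pd_y s\<^sub>2 p / pd_y s\<^sub>1 p"
    and "\<forall>p\<in>D. \<rho>\<^sub>1 p = lam\<^sub>1 p * B p - A p"
    and "\<forall>p\<in>D. \<rho>\<^sub>2 p = lam\<^sub>2 p * B p - A p"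
    and "\<forall>p\<in>D. lam\<^sub>1 p \<noteq> lam\<^sub>2 p"
  shows "\<forall>p\<in>D. \<forall>u v.
      (pd_x \<rho>\<^sub>1 p * pd_y \<rho>\<^sub>2 p) / (\<rho>\<^sub>1 p - \<rho>\<^sub>2 p)\<^sup>2 * dx_dy p u v
        = (pd_x lam\<^sub>1 p * pd_y lam\<^sub>2 p) / (lam\<^sub>1 p - lam\<^sub>2 p)\<^sup>2 * dx_dy p u v
    \<and> (pd_x lam\<^sub>1 p * pd_y lam\<^sub>2 p) / (lam\<^sub>1 p - lam\<^sub>2 p)\<^sup>2 * dx_dy p u v
        = pd_x \<phi> p * pd_y \<phi> p * dx_dy p u v
          - ext_d1 (\<lambda>q w. ext_d0 lam\<^sub>2 q w / (lam\<^sub>1 q - lam\<^sub>2 q)) p u v"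
proof (intro ballI allI)
  note sm_\<phi> = assms(2) and sm = assms(4-7) and sys\<^sub>1 = assms(8) and sys\<^sub>2 = assms(9)
    and sx = assms(10) and sy = assms(11) and smA = assms(12) and dA = assms(13) and B = assms(14)
    and lam\<^sub>1 = assms(15) and lam\<^sub>2 = assms(16) and \<rho>\<^sub>1 = assms(17) and \<rho>\<^sub>2 = assms(18) and ne = assms(19)
  have smL\<^sub>1: "smooth_on lam\<^sub>1 D"
    by (rule smooth_on_cong[OF assms(1) _ smooth_on_divide[OF assms(1) smooth_on_pd(1)[OF assms(1) sm(4)]
          smooth_on_pd(1)[OF assms(1) sm(2)]]]) (use sx lam\<^sub>1 in auto)
  have smL\<^sub>2: "smooth_on lam\<^sub>2 D"
    by (rule smooth_on_cong[OF assms(1) _ smooth_on_divide[OF assms(1) smooth_on_pd(2)[OF assms(1) sm(4)]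
          smooth_on_pd(2)[OF assms(1) sm(2)]]]) (use sy lam\<^sub>2 in auto)
  fix p u v assume p: "p \<in> D"
  note D = assms(1) p
  note d = smooth_on_has_derivative[OF _ p]
  have nz: "pd_x s\<^sub>1 p \<noteq> 0" "pd_y s\<^sub>1 p \<noteq> 0" "lam\<^sub>1 p - lam\<^sub>2 p \<noteq> 0" using sx sy ne p by auto
  have "(\<kappa>\<^sub>1 p)\<^sup>2 + (s\<^sub>1 p)\<^sup>2 + 1 > 0" by (simp add: add_nonneg_pos)
  then have Bpos: "B p > 0" using B[rule_format, OF p] by simp
  have S: "pd_x s\<^sub>2 p = lam\<^sub>1 p * pd_x s\<^sub>1 p" "pd_y s\<^sub>2 p = lam\<^sub>2 p * pd_y s\<^sub>1 p"
    using lam\<^sub>1 lam\<^sub>2 nz p by auto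

  \<comment> \<open>Derivatives of \<open>A\<close>, \<open>B\<close> and the radii\<close>
  have dB: "(B has_derivative (\<lambda>w. \<kappa>\<^sub>1 p * (pd_x \<kappa>\<^sub>1 p * fst w + pd_y \<kappa>\<^sub>1 p * snd w)
      + s\<^sub>1 p * (pd_x s\<^sub>1 p * fst w + pd_y s\<^sub>1 p * snd w))) (at p)"
    by (rule has_derivative_transform_within_open[OF _ D, of "\<lambda>p. 1/2 * ((\<kappa>\<^sub>1 p)\<^sup>2 + (s\<^sub>1 p)\<^sup>2 + 1)"])
      (use B in \<open>auto intro!: derivative_eq_intros d sm simp: fun_eq_iff add_divide_distrib algebra_simps\<close>)
  have B_xy: "pd_x B p = \<kappa>\<^sub>1 p * pd_x \<kappa>\<^sub>1 p + s\<^sub>1 p * pd_x s\<^sub>1 p"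
      "pd_y B p = \<kappa>\<^sub>1 p * pd_y \<kappa>\<^sub>1 p + s\<^sub>1 p * pd_y s\<^sub>1 p"
    using pd_x_eq[OF dB] pd_y_eq[OF dB] by simp_all
  have dB': "(B has_derivative (\<lambda>w. pd_x B p * fst w + pd_y B p * snd w)) (at p)"
    using dB by (intro has_derivative_pd differentiableI)
  have dA': "pd_x A p * fst w + pd_y A p * snd w = \<kappa>\<^sub>1 p * (pd_x \<kappa>\<^sub>2 p * fst w + pd_y \<kappa>\<^sub>2 p * snd w)
      + s\<^sub>1 p * (pd_x s\<^sub>2 p * fst w + pd_y s\<^sub>2 p * snd w)" for w
    using dA p by (simp add: ext_d0_eq smooth_on_differentiable[OF smA]
        smooth_on_differentiable[OF sm(3)] smooth_on_differentiable[OF sm(4)])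
  \<comment> \<open>Both solutions satisfy the same linear system, so \<open>S\<close> carries over
    to \<kappa>: the x-derivatives of the second solution are \<open>lam\<^sub>1 p\<close> times
    those of the first, the y-derivatives \<open>lam\<^sub>2 p\<close> times.\<close>
  have A_xy: "pd_x A p = lam\<^sub>1 p * pd_x B p" "pd_y A p = lam\<^sub>2 p * pd_y B p"
    using dA'[of "(1, 0)"] dA'[of "(0, 1)"] sys\<^sub>1 sys\<^sub>2 p S by (simp_all add: B_xy algebra_simps)
  have "(\<rho>\<^sub>1 has_derivative (\<lambda>w. (pd_x lam\<^sub>1 p * fst w + pd_y lam\<^sub>1 p * snd w) * B p
      + lam\<^sub>1 p * (pd_x B p * fst w + pd_y B p * snd w) - (pd_x A p * fst w + pd_y A p * snd w))) (at p)"
    by (rule has_derivative_transform_within_open[OF _ D, of "\<lambda>p. lam\<^sub>1 p * B p - A p"])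
      (use \<rho>\<^sub>1 in \<open>auto intro!: derivative_eq_intros d smL\<^sub>1 smA dB'\<close>)
  \<comment> \<open>The terms \<open>lam\<^sub>1 p * pd_x B p\<close> and \<open>pd_x A p\<close>
    cancel.\<close>
  from pd_x_eq[OF this] have \<rho>\<^sub>1_x: "pd_x \<rho>\<^sub>1 p = pd_x lam\<^sub>1 p * B p" using A_xy by simp
  have "(\<rho>\<^sub>2 has_derivative (\<lambda>w. (pd_x lam\<^sub>2 p * fst w + pd_y lam\<^sub>2 p * snd w) * B p
      + lam\<^sub>2 p * (pd_x B p * fst w + pd_y B p * snd w) - (pd_x A p * fst w + pd_y A p * snd w))) (at p)"
    by (rule has_derivative_transform_within_open[OF _ D, of "\<lambda>p. lam\<^sub>2 p * B p - A p"])
      (use \<rho>\<^sub>2 in \<open>auto intro!: derivative_eq_intros d smL\<^sub>2 smA dB'\<close>)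
  from pd_y_eq[OF this] have \<rho>\<^sub>2_y: "pd_y \<rho>\<^sub>2 p = pd_y lam\<^sub>2 p * B p" using A_xy by simp
  have \<rho>_diff: "\<rho>\<^sub>1 p - \<rho>\<^sub>2 p = (lam\<^sub>1 p - lam\<^sub>2 p) * B p"
    using \<rho>\<^sub>1[rule_format, OF p] \<rho>\<^sub>2[rule_format, OF p] by (simp add: left_diff_distrib)
  have density: "(pd_x \<rho>\<^sub>1 p * pd_y \<rho>\<^sub>2 p) / (\<rho>\<^sub>1 p - \<rho>\<^sub>2 p)\<^sup>2
      = (pd_x lam\<^sub>1 p * pd_y lam\<^sub>2 p) / (lam\<^sub>1 p - lam\<^sub>2 p)\<^sup>2"
    using Bpos by (simp add: \<rho>\<^sub>1_x \<rho>\<^sub>2_y \<rho>_diff power2_eq_square)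

  \<comment> \<open>The cross derivatives of the two quotients\<close>
  note cc\<^sub>1 = compatibility_condition[OF D sm_\<phi> sm(1,2) assms(3) sys\<^sub>1]
    and cc\<^sub>2 = compatibility_condition[OF D sm_\<phi> sm(3,4) assms(3) sys\<^sub>2]
  have tc: "tan (\<phi> p) * cot (\<phi> p) = 1" using assms(3) p by (simp add: tan_def cot_def)
  \<comment> \<open>Differentiate \<open>s\<^sup>2\<^sub>x = \<lambda>\<^sup>1 s\<^sup>1\<^sub>x\<close> in \<open>y\<close> and \<open>s\<^sup>2\<^sub>y = \<lambda>\<^sup>2 s\<^sup>1\<^sub>y\<close> in \<open>x\<close>.\<close>
  have "(pd_x s\<^sub>2 has_derivative (\<lambda>w. (pd_x lam\<^sub>1 p * fst w + pd_y lam\<^sub>1 p * snd w) * pd_x s\<^sub>1 p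
      + lam\<^sub>1 p * (pd_x (pd_x s\<^sub>1) p * fst w + pd_y (pd_x s\<^sub>1) p * snd w))) (at p)"
    by (rule has_derivative_transform_within_open[OF _ D, of "\<lambda>p. lam\<^sub>1 p * pd_x s\<^sub>1 p"])
      (use lam\<^sub>1 sx in \<open>auto intro!: derivative_eq_intros d smL\<^sub>1 smooth_on_pd(1)[OF assms(1) sm(2)]\<close>)
  from pd_y_eq[OF this] have "pd_y (pd_x s\<^sub>2) p = pd_y lam\<^sub>1 p * pd_x s\<^sub>1 p + lam\<^sub>1 p * pd_y (pd_x s\<^sub>1) p"
    by simp
  \<comment> \<open>After both mixed derivatives are replaced, the tan terms agree and only the cot
    terms remain; for \<open>L\<^sub>2\<close> it is the other way round.\<close>
  then have L\<^sub>1: "pd_y lam\<^sub>1 p * pd_x s\<^sub>1 p = - (cot (\<phi> p) * pd_x \<phi> p * (lam\<^sub>1 p - lam\<^sub>2 p) * pd_y s\<^sub>1 p)"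
    unfolding cc\<^sub>1 cc\<^sub>2 S by (simp add: algebra_simps)
  have "(pd_y s\<^sub>2 has_derivative (\<lambda>w. (pd_x lam\<^sub>2 p * fst w + pd_y lam\<^sub>2 p * snd w) * pd_y s\<^sub>1 p
      + lam\<^sub>2 p * (pd_x (pd_y s\<^sub>1) p * fst w + pd_y (pd_y s\<^sub>1) p * snd w))) (at p)"
    by (rule has_derivative_transform_within_open[OF _ D, of "\<lambda>p. lam\<^sub>2 p * pd_y s\<^sub>1 p"])
      (use lam\<^sub>2 sy in \<open>auto intro!: derivative_eq_intros d smL\<^sub>2 smooth_on_pd(2)[OF assms(1) sm(2)]\<close>)
  from pd_x_eq[OF this] have "pd_y (pd_x s\<^sub>2) p = pd_x lam\<^sub>2 p * pd_y s\<^sub>1 p + lam\<^sub>2 p * pd_y (pd_x s\<^sub>1) p"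
    using pd_commute[OF assms(1) sm(2) p] pd_commute[OF assms(1) sm(4) p] by simp
  then have L\<^sub>2: "pd_x lam\<^sub>2 p * pd_y s\<^sub>1 p = - (tan (\<phi> p) * pd_y \<phi> p * (lam\<^sub>1 p - lam\<^sub>2 p) * pd_x s\<^sub>1 p)"
    unfolding cc\<^sub>1 cc\<^sub>2 S by (simp add: algebra_simps)
  \<comment> \<open>In the product of \<open>L\<^sub>1\<close> and \<open>L\<^sub>2\<close> the
    factors tan and cot multiply to 1, and the derivatives of \<open>s\<^sub>1\<close> occur on both
    sides and can be cancelled.\<close>
  have "(pd_y lam\<^sub>1 p * pd_x lam\<^sub>2 p) * (pd_x s\<^sub>1 p * pd_y s\<^sub>1 p)
      = (pd_y lam\<^sub>1 p * pd_x s\<^sub>1 p) * (pd_x lam\<^sub>2 p * pd_y s\<^sub>1 p)" by (simp only: ac_simps)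
  also have "\<dots> = (tan (\<phi> p) * cot (\<phi> p)) * (pd_x \<phi> p * pd_y \<phi> p * (lam\<^sub>1 p - lam\<^sub>2 p)\<^sup>2)
      * (pd_x s\<^sub>1 p * pd_y s\<^sub>1 p)"
    unfolding L\<^sub>1 L\<^sub>2 power2_eq_square minus_mult_minus by (simp only: ac_simps)
  finally have cross: "pd_y lam\<^sub>1 p * pd_x lam\<^sub>2 p = pd_x \<phi> p * pd_y \<phi> p * (lam\<^sub>1 p - lam\<^sub>2 p)\<^sup>2"
    using nz by (simp add: tc)

  \<comment> \<open>The exterior derivative and the conclusion\<close>
  have dL: "((\<lambda>q. lam\<^sub>1 q - lam\<^sub>2 q) has_derivative (\<lambda>w. (pd_x lam\<^sub>1 p * fst w + pd_y lam\<^sub>1 p * snd w)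
      - (pd_x lam\<^sub>2 p * fst w + pd_y lam\<^sub>2 p * snd w))) (at p)"
    by (intro has_derivative_diff d smL\<^sub>1 smL\<^sub>2)
  have "ext_d1 (\<lambda>q w. ext_d0 lam\<^sub>2 q w / (lam\<^sub>1 q - lam\<^sub>2 q)) p u v
      = - ((pd_x lam\<^sub>1 p * pd_y lam\<^sub>2 p - pd_y lam\<^sub>1 p * pd_x lam\<^sub>2 p) / (lam\<^sub>1 p - lam\<^sub>2 p)\<^sup>2) * dx_dy p u v"
    using ext_d1_divide[OF D smL\<^sub>2 differentiableI[OF dL] nz(3)] pd_x_eq[OF dL] pd_y_eq[OF dL]
    by (simp add: algebra_simps)
  \<comment> \<open>By \<open>cross\<close>, the second half of the Jacobian of
    \<open>lam\<^sub>1\<close> and \<open>lam\<^sub>2\<close>, divided by the squared difference, is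
    the product of the derivatives of \<phi>.\<close>
  also have "\<dots> = (pd_x \<phi> p * pd_y \<phi> p - (pd_x lam\<^sub>1 p * pd_y lam\<^sub>2 p) / (lam\<^sub>1 p - lam\<^sub>2 p)\<^sup>2) * dx_dy p u v"
    unfolding cross using nz(3) by (simp add: diff_divide_distrib)
  finally show "(pd_x \<rho>\<^sub>1 p * pd_y \<rho>\<^sub>2 p) / (\<rho>\<^sub>1 p - \<rho>\<^sub>2 p)\<^sup>2 * dx_dy p u v
        = (pd_x lam\<^sub>1 p * pd_y lam\<^sub>2 p) / (lam\<^sub>1 p - lam\<^sub>2 p)\<^sup>2 * dx_dy p u v
    \<and> (pd_x lam\<^sub>1 p * pd_y lam\<^sub>2 p) / (lam\<^sub>1 p - lam\<^sub>2 p)\<^sup>2 * dx_dy p u v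
        = pd_x \<phi> p * pd_y \<phi> p * dx_dy p u v
          - ext_d1 (\<lambda>q w. ext_d0 lam\<^sub>2 q w / (lam\<^sub>1 q - lam\<^sub>2 q)) p u v"
    by (simp add: density left_diff_distrib)
qed

end
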